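(* Let $n$ be a positive integer. For both the Combine Largest game on $n$ and the Split Largest game on $n$, the total number of splitting moves is $MS(n) = 0$ and the total number of combining moves is $MC(n) = n - Z(n)$. In particular both games realize the lower bound $n - Z(n)$ for the number of moves in a Zeckendorf game on $n$.
   Context: Fibonacci numbers are normalized by $F_1 = 1$, $F_2 = 2$, $F_{i+1} = F_i + F_{i-1}$ for $i\ge 2$. By Zeckendorf's theorem every positive integer $n$ has a unique representation (its Zeckendorf decomposition) as a sum of distinct, non-adjacent Fibonacci numbers $F_i$, $i \ge 1$ (no two indices equal or consecutive). $Z(n)$ is the number of terms in the Zeckendorf decomposition of $n$. The Zeckendorf game on $n$: a state is an unordered list (multiset) of Fibonacci numbers, recorded by their indices, with sum $n$. The initial state is $\{F_1^n\}$, i.e. $n$ copies of $F_1$. On each turn one of the following moves is made: - adding consecutive indices at $i$ ($i\ge 2$): if the list contains $F_{i-1}, F_i$, replace one copy of each by one $F_{i+1}$; - adding 1's: if the list contains two copies of $F_1$, replace $F_1,F_1$ by $F_2$; - splitting at $i$ ($i \ge 2$): if the list contains two copies of $F_i$, replace $F_i,F_i$ by $F_1,F_3$ if $i=2$, and by $F_{i-2},F_{i+1}$ if $i\ge 3$. The game ends when the list is the Zeckendorf decomposition of $n$. The first two kinds of move are called combining moves, and the third kind splitting moves. The lower bound on the number of moves of any Zeckendorf game on $n$ is $n-Z(n)$. In a deterministic game, at each turn the move made is the first available one in a fixed priority order. The orders are: - Combine Largest: adding consecutive indices, from largest index to smallest; then adding 1's; then splitting, from largest index to smallest. - Split Largest: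 splitting, from largest index to smallest; then adding consecutive indices, from largest index to smallest; then adding 1's. $MC(n)$ and $MS(n)$ denote the total number of combining moves and of splitting moves, respectively, made in the game. *)

theory Defs
  imports "HOL-Number_Theory.Fib" "HOL-Library.Multiset"
begin

text \<open>The library has \<open>fib 1 = fib 2 = 1\<close>; the normalization used here is
  \<open>F 1 = 1\<close>, \<open>F 2 = 2\<close>, so the index is shifted by one. Only indices \<open>i \<ge> 1\<close> are used.\<close>

definition F :: "nat \<Rightarrow> nat" where
  "F i = fib (Suc i)"

lemma F_1: "F 1 = 1" and F_2: "F 2 = 2"
  by (simp_all add: F_def numeral_eq_Suc)

lemma F_rec: "i \<ge> 1 \<Longrightarrow> F (i + 1) = F i + F (i - 1)"
  by (cases i) (simp_all add: F_def)

text \<open>A list of Fibonacci numbers is the multiset of their indices.\<close>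

definition zeckendorf_decomp :: "nat \<Rightarrow> nat multiset \<Rightarrow> bool" where
  "zeckendorf_decomp n s \<longleftrightarrow>
     (\<forall>i \<in># s. i \<ge> 1) \<and>
     (\<forall>i. count s i \<le> 1) \<and>
     (\<forall>i. \<not> (i \<in># s \<and> i + 1 \<in># s)) \<and>
     (\<Sum>i \<in># s. F i) = n"

lemma F_mono: "i \<le> j \<Longrightarrow> F i \<le> F j"
  by (simp add: F_def fib_mono)

lemma F_ge: "i \<le> F i"
proof (induction i rule: fib.induct)
  case (3 i)
  have "F (Suc (Suc i)) = F (Suc i) + F i" by (simp add: F_def)
  moreover have "F i \<ge> 1" using F_mono[of 0 i] by (simp add: F_def)
  ultimately show ?case using 3 by simp
qed (simp_all add: F_def)

lemma zeckendorf_decomp_remove: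
  assumes "zeckendorf_decomp n (add_mset k t)"
  shows "zeckendorf_decomp (n - F k) t" "F k \<le> n" "k \<ge> 1" "k \<notin># t" "k - 1 \<notin># t"
proof -
  note z = assms[unfolded zeckendorf_decomp_def]
  have c: "count t i \<le> 1" for i
  proof -
    have "count t i \<le> count (add_mset k t) i" by simp
    also have "\<dots> \<le> 1" using z by blast
    finally show ?thesis .
  qed
  show "zeckendorf_decomp (n - F k) t"
    unfolding zeckendorf_decomp_def using z c by auto
  show "F k \<le> n" using z by auto
  show k: "k \<ge> 1" using z by simp
  have "count (add_mset k t) k \<le> 1" using z by blast
  then show "k \<notin># t" by (simp add: not_in_iff)
  have "\<not> (k - 1 \<in># add_mset k t \<and> (k - 1) + 1 \<in># add_mset k t)" using z by blast
  then show "k - 1 \<notin># t" using k by simp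
qed

lemma zeckendorf_decomp_le:
  assumes "zeckendorf_decomp n s" "i \<in># s"
  shows "F i \<le> n"
proof -
  obtain t where "s = add_mset i t" using assms(2) by (metis mset_add)
  then show ?thesis using zeckendorf_decomp_remove(2) assms(1) by blast
qed

lemma zeckendorf_decomp_less:
  "zeckendorf_decomp n s \<Longrightarrow> (\<And>i. i \<in># s \<Longrightarrow> i \<le> k) \<Longrightarrow> n < F (k + 1)"
proof (induction k arbitrary: n s rule: less_induct)
  case (less k)
  show ?case
  proof (cases "k \<in># s")
    case False
    show ?thesis
    proof (cases k)
      case 0
      then have "s = {#}" using False less.prems(2) by (metis le_zero_eq multiset_nonemptyE)
      then show ?thesis using less.prems(1) 0 by (simp add: zeckendorf_decomp_def F_def)
    next
      case (Suc k')
      have "n < F (k' + 1)"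
        using less.prems False Suc by (intro less.IH[of k' n s]) (auto simp: le_Suc_eq)
      then show ?thesis using F_mono[of "k' + 1" "k + 1"] Suc by simp
    qed
  next
    case True
    then obtain t where t: "s = add_mset k t" by (metis mset_add)
    note rem = zeckendorf_decomp_remove[OF less.prems(1)[unfolded t]]
    note zt = rem(1) and n = rem(2) and k = rem(3) and kt = rem(4) and kt' = rem(5)
    show ?thesis
    proof (cases "k = 1")
      case True
      have "i = 0" if "i \<in># t" for i
        using less.prems(2)[of i] that kt t True by (cases i) auto
      moreover have "i \<ge> 1" if "i \<in># t" for i
        using zt that by (simp add: zeckendorf_decomp_def)
      ultimately have "t = {#}" by (metis multiset_nonemptyE not_one_le_zero)
      then have "n = 1" using less.prems(1) t True F_1 by (simp add: zeckendorf_decomp_def)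
      then show ?thesis using True F_2 by (simp add: numeral_2_eq_2)
    next
      case False
      have "n - F k < F ((k - 2) + 1)"
      proof (rule less.IH[OF _ zt])
        fix i assume "i \<in># t"
        then have "i \<le> k" "i \<noteq> k" "i \<noteq> k - 1" using less.prems(2) t kt kt' by auto
        then show "i \<le> k - 2" by linarith
      qed (use k in simp)
      then have "n - F k < F (k - 1)" using k False by (simp add: Suc_diff_Suc numeral_2_eq_2)
      then show ?thesis using F_rec[OF k] n by simp
    qed
  qed
qed

lemma zeckendorf_theorem: "\<exists>!s. zeckendorf_decomp n s"
proof (induction n rule: less_induct)
  case (less n)
  show ?case
  proof (cases "n = 0")
    case True
    have "s = {#}" if "zeckendorf_decomp 0 s" for s
    proof (rule ccontr)
      assume "s \<noteq> {#}"
      then obtain i where "i \<in># s" by blast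
      then have "i \<ge> 1" "F i = 0" using that by (auto simp: zeckendorf_decomp_def)
      then show False using F_ge[of i] by simp
    qed
    moreover have "zeckendorf_decomp 0 {#}" by (simp add: zeckendorf_decomp_def)
    ultimately show ?thesis using True by blast
  next
    case False
    define k where "k = (GREATEST k. F k \<le> n)"
    have bd: "\<forall>y. F y \<le> n \<longrightarrow> y \<le> n" using F_ge le_trans by blast
    have F1: "F 1 \<le> n" using False by (simp add: F_def)
    have kn: "F k \<le> n" unfolding k_def using GreatestI_nat[of "\<lambda>k. F k \<le> n", OF F1] bd by blast
    have kmax: "i \<le> k" if "F i \<le> n" for i
      unfolding k_def using Greatest_le_nat[of "\<lambda>k. F k \<le> n", OF that] bd by blast
    have k1: "k \<ge> 1" using kmax[OF F1] .
    have kS: "n < F (k + 1)" using kmax[of "k + 1"] by fastforce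
    have pos: "F k > 0" using F_ge[of k] k1 by linarith
    from less[of "n - F k"] pos False obtain t where
      t: "zeckendorf_decomp (n - F k) t" and tu: "\<And>s. zeckendorf_decomp (n - F k) s \<Longrightarrow> s = t"
      by (metis diff_less neq0_conv)
    have small: "i + 1 < k" if "i \<in># t" for i
    proof (rule ccontr)
      assume "\<not> i + 1 < k"
      then have "F (k - 1) \<le> F i" by (intro F_mono) simp
      also have "F i \<le> n - F k" using zeckendorf_decomp_le[OF t that] .
      finally show False using F_rec[OF k1] kS kn by simp
    qed
    have "zeckendorf_decomp n (add_mset k t)"
      unfolding zeckendorf_decomp_def
    proof (intro conjI allI ballI)
      show "1 \<le> i" if "i \<in># add_mset k t" for i
        using that k1 t by (auto simp: zeckendorf_decomp_def)
      show "count (add_mset k t) i \<le> 1" for i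
      proof (cases "i = k")
        case True
        then have "i \<notin># t" using small by fastforce
        then show ?thesis using True by (simp add: not_in_iff)
      next
        case False
        then show ?thesis using t by (simp add: zeckendorf_decomp_def)
      qed
      show "\<not> (i \<in># add_mset k t \<and> i + 1 \<in># add_mset k t)" for i
        using small[of i] small[of "i + 1"] t by (auto simp: zeckendorf_decomp_def)
      show "(\<Sum>i\<in>#add_mset k t. F i) = n" using t kn by (simp add: zeckendorf_decomp_def)
    qed
    moreover have "s = add_mset k t" if s: "zeckendorf_decomp n s" for s
    proof -
      have le: "i \<le> k" if "i \<in># s" for i
        using kmax zeckendorf_decomp_le[OF s that] by blast
      have "k \<in># s"
      proof (rule ccontr)
        assume "k \<notin># s"
        then have "i \<le> k - 1" if "i \<in># s" for i using le[OF that] that by (cases "i = k") auto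
        from zeckendorf_decomp_less[OF s this] show False using k1 kn by simp
      qed
      then obtain u where u: "s = add_mset k u" by (metis mset_add)
      have "zeckendorf_decomp (n - F k) u"
        using zeckendorf_decomp_remove(1) s u by blast
      then show ?thesis using tu u by blast
    qed
    ultimately show ?thesis by blast
  qed
qed

definition Z :: "nat \<Rightarrow> nat" where
  "Z n = size (THE s. zeckendorf_decomp n s)"

text \<open>\<open>Add i\<close> adds consecutive indices at \<open>i\<close>, \<open>AddOnes\<close> adds 1's, \<open>Split i\<close> splits at \<open>i\<close>.\<close>

datatype move = Add nat | AddOnes | Split nat

fun valid_index :: "move \<Rightarrow> bool" where
  "valid_index (Add i) \<longleftrightarrow> i \<ge> 2"
| "valid_index AddOnes \<longleftrightarrow> True"
| "valid_index (Split i) \<longleftrightarrow> i \<ge> 2"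

fun removed :: "move \<Rightarrow> nat multiset" where
  "removed (Add i) = {#i - 1, i#}"
| "removed AddOnes = {#1, 1#}"
| "removed (Split i) = {#i, i#}"

fun inserted :: "move \<Rightarrow> nat multiset" where
  "inserted (Add i) = {#i + 1#}"
| "inserted AddOnes = {#2#}"
| "inserted (Split i) = (if i = 2 then {#1, 3#} else {#i - 2, i + 1#})"

definition available :: "nat multiset \<Rightarrow> move \<Rightarrow> bool" where
  "available s m \<longleftrightarrow> valid_index m \<and> removed m \<subseteq># s"

definition make_move :: "move \<Rightarrow> nat multiset \<Rightarrow> nat multiset" where
  "make_move m s = s - removed m + inserted m"

text \<open>\<open>play rule n s ms\<close>: from state \<open>s\<close>, the moves \<open>ms\<close>, each allowed by \<open>rule\<close> in the state
  in which it is made, are played until the state is the Zeckendorf decomposition of \<open>n\<close>.\<close>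

inductive play ::
  "(nat multiset \<Rightarrow> move \<Rightarrow> bool) \<Rightarrow> nat \<Rightarrow> nat multiset \<Rightarrow> move list \<Rightarrow> bool"
  for rule :: "nat multiset \<Rightarrow> move \<Rightarrow> bool" and n :: nat where
  finish: "zeckendorf_decomp n s \<Longrightarrow> play rule n s []"
| step: "\<not> zeckendorf_decomp n s \<Longrightarrow> rule s m \<Longrightarrow> play rule n (make_move m s) ms
    \<Longrightarrow> play rule n s (m # ms)"

definition initial_state :: "nat \<Rightarrow> nat multiset" where
  "initial_state n = replicate_mset n 1"

definition zeckendorf_game :: "nat \<Rightarrow> move list \<Rightarrow> bool" where
  "zeckendorf_game n ms \<longleftrightarrow> play available n (initial_state n) ms"

text \<open>A priority order is a strict order on moves; \<open>ord m m'\<close> means that \<open>m\<close> has priority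
  over \<open>m'\<close>.\<close>

definition first_available :: "(move \<Rightarrow> move \<Rightarrow> bool) \<Rightarrow> nat multiset \<Rightarrow> move \<Rightarrow> bool" where
  "first_available ord s m \<longleftrightarrow>
     available s m \<and> (\<forall>m'. available s m' \<and> m' \<noteq> m \<longrightarrow> ord m m')"

definition deterministic_game :: "(move \<Rightarrow> move \<Rightarrow> bool) \<Rightarrow> nat \<Rightarrow> move list \<Rightarrow> bool" where
  "deterministic_game ord n ms \<longleftrightarrow> play (first_available ord) n (initial_state n) ms"

fun combine_largest :: "move \<Rightarrow> move \<Rightarrow> bool" where
  "combine_largest (Add i) (Add j) \<longleftrightarrow> i > j"
| "combine_largest (Add i) AddOnes \<longleftrightarrow> True"
| "combine_largest (Add i) (Split j) \<longleftrightarrow> True"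
| "combine_largest AddOnes (Split j) \<longleftrightarrow> True"
| "combine_largest (Split i) (Split j) \<longleftrightarrow> i > j"
| "combine_largest _ _ \<longleftrightarrow> False"

fun split_largest :: "move \<Rightarrow> move \<Rightarrow> bool" where
  "split_largest (Split i) (Split j) \<longleftrightarrow> i > j"
| "split_largest (Split i) (Add j) \<longleftrightarrow> True"
| "split_largest (Split i) AddOnes \<longleftrightarrow> True"
| "split_largest (Add i) (Add j) \<longleftrightarrow> i > j"
| "split_largest (Add i) AddOnes \<longleftrightarrow> True"
| "split_largest _ _ \<longleftrightarrow> False"

fun is_split :: "move \<Rightarrow> bool" where
  "is_split (Split i) \<longleftrightarrow> True"
| "is_split _ \<longleftrightarrow> False"

text \<open>Since each turn has at most one first available move, there is at most one deterministic
  game for a given order and \<open>n\<close>. The description below is meaningful whenever that game ends.\<close>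

definition game_moves :: "(move \<Rightarrow> move \<Rightarrow> bool) \<Rightarrow> nat \<Rightarrow> move list" where
  "game_moves ord n = (THE ms. deterministic_game ord n ms)"

definition MS :: "(move \<Rightarrow> move \<Rightarrow> bool) \<Rightarrow> nat \<Rightarrow> nat" where
  "MS ord n = length (filter is_split (game_moves ord n))"

definition MC :: "(move \<Rightarrow> move \<Rightarrow> bool) \<Rightarrow> nat \<Rightarrow> nat" where
  "MC ord n = length (filter (\<lambda>m. \<not> is_split m) (game_moves ord n))"

end

theory Submission
  imports Defs
begin

text \<open>A combining move lowers the number of terms by one and a splitting move preserves it, so
  every game has at least \<open>n - Z n\<close> moves, with equality if no splitting move is made. In both
  games the state keeps the following shape: every index \<open>\<ge> 2\<close> occurs at most once, and at most
  one pair of consecutive indices \<open>\<ge> 2\<close> is present. Such a state admits no splitting move, so both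
  orders choose the same combining move. Adding the only pair \<open>i - 1, i\<close> produces an index \<open>i + 1\<close>
  that was absent and can only create the pair \<open>i + 1, i + 2\<close>; if no pair is left, adding \<open>1, 2\<close>
  or \<open>1, 1\<close> similarly creates at most the pair starting at the new index.\<close>

text \<open>Index \<open>1\<close> is exempt, since the game starts from copies of \<open>1\<close>
  alone: it may be repeated, and the pair \<open>1\<close>, \<open>2\<close> is not counted.\<close>

definition almost_sparse :: "nat multiset \<Rightarrow> bool" where
  "almost_sparse s \<longleftrightarrow> (\<forall>i\<ge>2. count s i \<le> 1) \<and>
     (\<forall>i\<ge>2. \<forall>j\<ge>2. i \<in># s \<and> i + 1 \<in># s \<and> j \<in># s \<and> j + 1 \<in># s \<longrightarrow> i = j)"

definition is_state :: "nat \<Rightarrow> nat multiset \<Rightarrow> bool" where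
  "is_state n s \<longleftrightarrow> (\<forall>i\<in>#s. i \<ge> 1) \<and> (\<Sum>i\<in>#s. F i) = n"

definition combining_order :: "(move \<Rightarrow> move \<Rightarrow> bool) \<Rightarrow> bool" where
  "combining_order ord \<longleftrightarrow> (\<forall>m m'. ord m m' \<longrightarrow> \<not> ord m' m) \<and>
     (\<forall>i j. j < i \<longrightarrow> ord (Add i) (Add j)) \<and> (\<forall>i. ord (Add i) AddOnes)"

lemma combining_order_combine_largest: "combining_order combine_largest"
proof -
  have "combine_largest m m' \<Longrightarrow> \<not> combine_largest m' m" for m m'
    by (cases m; cases m') auto
  then show ?thesis by (auto simp: combining_order_def)
qed

lemma combining_order_split_largest: "combining_order split_largest"
proof -
  have "split_largest m m' \<Longrightarrow> \<not> split_largest m' m" for m m'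
    by (cases m; cases m') auto
  then show ?thesis by (auto simp: combining_order_def)
qed

section \<open>Availability of moves and preservation of the invariant\<close>

lemma double_subset_iff: "{#a, a#} \<subseteq># s \<longleftrightarrow> count s a \<ge> 2"
  by (auto simp: subseteq_mset_def)

lemma pair_subset_iff: "a \<noteq> b \<Longrightarrow> {#a, b#} \<subseteq># s \<longleftrightarrow> a \<in># s \<and> b \<in># s"
  by (auto simp: subseteq_mset_def Suc_le_eq simp flip: count_greater_zero_iff)

lemma available_Add_iff: "available s (Add i) \<longleftrightarrow> i \<ge> 2 \<and> i - 1 \<in># s \<and> i \<in># s"
  using pair_subset_iff[of "i - 1" i s] by (auto simp: available_def)

lemma available_AddOnes_iff: "available s AddOnes \<longleftrightarrow> count s 1 \<ge> 2"
  by (simp add: available_def double_subset_iff)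

lemma available_Split_iff: "available s (Split i) \<longleftrightarrow> i \<ge> 2 \<and> count s i \<ge> 2"
  by (simp add: available_def double_subset_iff)

lemma almost_sparse_not_Split: "almost_sparse s \<Longrightarrow> \<not> available s (Split i)"
  by (force simp: almost_sparse_def available_Split_iff)

text \<open>Here \<open>t\<close> is what a move leaves of \<open>s\<close>, and \<open>k\<close> is
  the new index. As \<open>t\<close> has no pair from 2 on, a counted pair must contain
  \<open>k\<close>; it cannot be \<open>k - 1\<close>, \<open>k\<close>, so only \<open>k\<close>,
  \<open>k + 1\<close> is possible.\<close>

lemma almost_sparse_combine:
  assumes s: "almost_sparse s" and t: "t \<subseteq># s" and k: "k \<ge> 2" "k \<notin># t" "k = 2 \<or> k - 1 \<notin># t"
    and np: "\<And>i. i \<ge> 2 \<Longrightarrow> i \<in># t \<Longrightarrow> i + 1 \<notin># t"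
  shows "almost_sparse (add_mset k t)"
proof -
  have "count (add_mset k t) i \<le> 1" if "i \<ge> 2" for i
  proof (cases "i = k")
    case True
    then show ?thesis using k by (simp add: not_in_iff)
  next
    case False
    have "count t i \<le> count s i" using t by (simp add: mset_subset_eq_count)
    also have "\<dots> \<le> 1" using s that by (simp add: almost_sparse_def)
    finally show ?thesis using False by simp
  qed
  moreover have "i = k" if "i \<ge> 2" "i \<in># add_mset k t" "i + 1 \<in># add_mset k t" for i
    using that np[of i] k by auto
  ultimately show ?thesis unfolding almost_sparse_def by blast
qed

lemma almost_sparse_Add:
  assumes s: "almost_sparse s" and av: "available s (Add i)"
    and max: "\<And>j. available s (Add j) \<Longrightarrow> j \<le> i"
  shows "almost_sparse (make_move (Add i) s)"
proof -
  from av have i: "i \<ge> 2" "i - 1 \<in># s" "i \<in># s" by (auto simp: available_Add_iff)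
  have next_absent: "i + 1 \<notin># s" using max[of "i + 1"] i by (auto simp: available_Add_iff)
  let ?t = "s - {#i - 1, i#}"
  have sub: "?t \<subseteq># s" by simp
  have "count s i \<le> 1" using s i by (simp add: almost_sparse_def)
  then have it: "i \<notin># ?t" by (simp add: not_in_iff)
  have "almost_sparse (add_mset (i + 1) ?t)"
  proof (rule almost_sparse_combine[OF s sub])
    show "i + 1 \<notin># ?t" using next_absent sub mset_subset_eqD by metis
    show "i + 1 = 2 \<or> i + 1 - 1 \<notin># ?t" using it by simp
    show "j + 1 \<notin># ?t" if j: "j \<ge> 2" "j \<in># ?t" for j
    proof
      assume "j + 1 \<in># ?t"
      with j have js: "j \<in># s" "j + 1 \<in># s" using sub mset_subset_eqD by metis+
      \<comment> \<open>With \<open>j \<ge> 2\<close> this also forces \<open>i \<ge> 3\<close>, so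
        uniqueness of the pair applies to \<open>i - 1\<close>.\<close>
      then have "j + 1 \<le> i" using max[of "j + 1"] j by (simp add: available_Add_iff)
      then have "j = i - 1"
        using s[unfolded almost_sparse_def, THEN conjunct2, rule_format, of j "i - 1"] i j js
        by simp
      with \<open>j + 1 \<in># ?t\<close> it i show False by simp
    qed
  qed (use i in simp)
  then show ?thesis by (simp add: make_move_def)
qed

text \<open>Without an available \<open>Add\<close> there are no consecutive positive indices, so
  \<open>2\<close> is absent while \<open>1\<close> is present. Copies of \<open>1\<close> left
  beside the new \<open>2\<close> do no harm to the invariant.\<close>

lemma almost_sparse_AddOnes:
  assumes s: "almost_sparse s" and av: "available s AddOnes"
    and none: "\<And>j. \<not> available s (Add j)"
  shows "almost_sparse (make_move AddOnes s)"
proof -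
  let ?t = "s - {#1, 1#}"
  have sub: "?t \<subseteq># s" by simp
  have np: "j + 1 \<notin># s" if "j \<in># s" "j \<ge> 1" for j
    using none[of "j + 1"] that by (simp add: available_Add_iff)
  have one: "1 \<in># s" using av by (simp add: available_AddOnes_iff flip: count_greater_zero_iff)
  have two: "2 \<notin># s" using np[OF one] by (simp add: numeral_2_eq_2)
  have "almost_sparse (add_mset 2 ?t)"
  proof (rule almost_sparse_combine[OF s sub])
    show "2 \<notin># ?t" using two sub mset_subset_eqD by metis
    show "j + 1 \<notin># ?t" if "j \<ge> 2" "j \<in># ?t" for j
    proof -
      have "j \<in># s" using that(2) sub mset_subset_eqD by metis
      then have "j + 1 \<notin># s" using np that(1) by simp
      then show ?thesis using sub mset_subset_eqD by metis
    qed
  qed simp_all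
  then show ?thesis by (simp add: make_move_def)
qed

section \<open>The initial state, and the effect of a move on the sum and the number of
  terms\<close>

lemma almost_sparse_initial_state: "almost_sparse (initial_state n)"
  by (auto simp: almost_sparse_def initial_state_def)

lemma is_state_initial_state: "is_state n (initial_state n)"
  by (simp add: is_state_def initial_state_def F_def)

lemma is_state_make_move:
  assumes s: "is_state n s" and av: "available s m" and m: "\<not> is_split m"
  shows "is_state n (make_move m s)"
proof -
  have rem: "removed m \<subseteq># s" and v: "valid_index m" using av by (auto simp: available_def)
  \<comment> \<open>The Fibonacci recurrence for \<open>Add\<close>, and
    \<open>F 2 = F 1 + F 1\<close> for \<open>AddOnes\<close>.\<close>
  have F: "(\<Sum>i\<in>#inserted m. F i) = (\<Sum>i\<in>#removed m. F i)"
    using m v F_rec F_1 F_2 by (cases m) (auto simp: numeral_2_eq_2)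
  have "(\<Sum>i\<in>#s. F i) = (\<Sum>i\<in>#s - removed m. F i) + (\<Sum>i\<in>#removed m. F i)"
    using rem by (metis image_mset_union subset_mset.diff_add sum_mset.union)
  moreover have "i \<ge> 1" if "i \<in># inserted m" for i
    using that m by (cases m) auto
  ultimately show ?thesis
    using s F by (auto simp: is_state_def make_move_def dest: in_diffD)
qed

lemma size_make_move:
  assumes "available s m"
  shows "size s = size (make_move m s) + (if is_split m then 0 else 1)"
proof -
  have rem: "removed m \<subseteq># s" using assms by (simp add: available_def)
  have "size (make_move m s) = size s - size (removed m) + size (inserted m)"
    unfolding make_move_def size_union size_Diff_submset[OF rem] ..
  moreover have "size (removed m) \<le> size s" using rem by (rule size_mset_mono)
  ultimately show ?thesis by (cases m) auto
qed

text \<open>A consecutive pair would allow \<open>Add\<close>, a repeated \<open>1\<close> would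
  allow \<open>AddOnes\<close>, and a repeated larger index contradicts the invariant.\<close>

lemma zeckendorf_decomp_terminal:
  assumes s: "is_state n s" and sp: "almost_sparse s"
    and no_add: "\<And>i. \<not> available s (Add i)" and no_ones: "\<not> available s AddOnes"
  shows "zeckendorf_decomp n s"
  unfolding zeckendorf_decomp_def
proof (intro conjI allI)
  show ge1: "\<forall>i\<in>#s. 1 \<le> i" and "(\<Sum>i\<in>#s. F i) = n" using s by (auto simp: is_state_def)
  show "count s i \<le> 1" for i
  proof -
    consider "i = 0" | "i = 1" | "i \<ge> 2" by linarith
    then show ?thesis
    proof cases
      case 1
      then have "i \<notin># s" using ge1 by auto
      then show ?thesis by (simp add: not_in_iff)
    next
      case 2
      then show ?thesis using no_ones by (simp add: available_AddOnes_iff)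
    next
      case 3
      then show ?thesis using sp by (simp add: almost_sparse_def)
    qed
  qed
  show "\<not> (i \<in># s \<and> i + 1 \<in># s)" for i
    using no_add[of "i + 1"] ge1 by (auto simp: available_Add_iff)
qed

lemma first_available_combining_exists:
  assumes ord: "combining_order ord" and s: "is_state n s" and sp: "almost_sparse s"
    and nz: "\<not> zeckendorf_decomp n s"
  shows "\<exists>m. first_available ord s m \<and> \<not> is_split m \<and> almost_sparse (make_move m s)"
proof (cases "\<exists>i. available s (Add i)")
  case True
  then obtain i0 where i0: "available s (Add i0)" ..
  define i where "i = (GREATEST i. available s (Add i))"
  \<comment> \<open>\<open>GREATEST\<close> needs a bound: an available \<open>Add j\<close> has
    \<open>j\<close> in the finite multiset \<open>s\<close>.\<close>
  have bound: "\<forall>j. available s (Add j) \<longrightarrow> j \<le> Max (set_mset s)"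
    by (simp add: available_Add_iff)
  have av: "available s (Add i)"
    unfolding i_def using GreatestI_nat[of "\<lambda>i. available s (Add i)", OF i0] bound by blast
  have max: "j \<le> i" if "available s (Add j)" for j
    unfolding i_def using Greatest_le_nat[of "\<lambda>i. available s (Add i)", OF that] bound by blast
  have "ord (Add i) m" if "available s m" "m \<noteq> Add i" for m
  proof (cases m)
    case (Add j)
    then have "j < i" using that max[of j] by auto
    then show ?thesis using ord Add by (simp add: combining_order_def)
  next
    case AddOnes
    then show ?thesis using ord by (simp add: combining_order_def)
  next
    case (Split j)
    then show ?thesis using that almost_sparse_not_Split[OF sp] by simp
  qed
  then have "first_available ord s (Add i)" using av by (simp add: first_available_def)
  then show ?thesis using almost_sparse_Add[OF sp av max] by (intro exI[of _ "Add i"]) simp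
next
  case False
  \<comment> \<open>With neither \<open>Add\<close> nor \<open>AddOnes\<close> available, the state
    would already be the decomposition.\<close>
  then have av: "available s AddOnes" using zeckendorf_decomp_terminal[OF s sp] nz by blast
  have "m = AddOnes" if "available s m" for m
    using that False almost_sparse_not_Split[OF sp] by (cases m) auto
  then have "first_available ord s AddOnes" using av by (auto simp: first_available_def)
  then show ?thesis using almost_sparse_AddOnes[OF sp av] False
    by (intro exI[of _ AddOnes]) simp
qed

section \<open>Existence, uniqueness and length of plays\<close>

lemma size_zeckendorf_decomp: "zeckendorf_decomp n s \<Longrightarrow> size s = Z n"
  unfolding Z_def using the1_equality[OF zeckendorf_theorem] by metis

text \<open>Termination comes from the number of terms, which every combining move lowers.\<close>

lemma combining_play_exists:
  assumes ord: "combining_order ord"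
  shows "is_state n s \<Longrightarrow> almost_sparse s \<Longrightarrow>
    \<exists>ms. play (first_available ord) n s ms \<and> (\<forall>m\<in>set ms. \<not> is_split m)"
proof (induction "size s" arbitrary: s rule: less_induct)
  case less
  show ?case
  proof (cases "zeckendorf_decomp n s")
    case True
    then show ?thesis by (intro exI[of _ "[]"]) (simp add: play.finish)
  next
    case False
    from first_available_combining_exists[OF ord less.prems False] obtain m
      where m: "first_available ord s m" "\<not> is_split m" "almost_sparse (make_move m s)" by blast
    have av: "available s m" using m(1) by (simp add: first_available_def)
    have "size (make_move m s) < size s" using size_make_move[OF av] m(2) by simp
    from less.hyps[OF this is_state_make_move[OF less.prems(1) av m(2)] m(3)] obtain ms
      where "play (first_available ord) n (make_move m s) ms" "\<forall>m\<in>set ms. \<not> is_split m"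
      by blast
    then show ?thesis using False m play.step by (intro exI[of _ "m # ms"]) auto
  qed
qed

text \<open>Serves to regard a deterministic game as a Zeckendorf game.\<close>

lemma play_mono:
  assumes "play r n s ms" and "\<And>s m. r s m \<Longrightarrow> r' s m"
  shows "play r' n s ms"
  using assms by (induction rule: play.induct) (auto intro: play.intros)

text \<open>Stopping is forced too: \<open>finish\<close> requires the decomposition and
  \<open>step\<close> its absence. Hence the description in \<open>game_moves\<close> denotes once a
  game exists.\<close>

lemma play_unique:
  assumes "\<And>s m m'. r s m \<Longrightarrow> r s m' \<Longrightarrow> m = m'"
  shows "play r n s ms \<Longrightarrow> play r n s ms' \<Longrightarrow> ms = ms'"
proof (induction arbitrary: ms' rule: play.induct)
  case (finish s)
  then show ?case by (auto elim: play.cases)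
next
  case (step s m ms)
  from step.prems step.hyps(1) obtain m' ms''
    where "ms' = m' # ms''" "r s m'" "play r n (make_move m' s) ms''"
    by (auto elim: play.cases)
  then show ?case using step.IH step.hyps(2) assms by metis
qed

text \<open>Two distinct first available moves would each have priority over the other, against
  asymmetry.\<close>

lemma first_available_unique:
  assumes "combining_order ord" "first_available ord s m" "first_available ord s m'"
  shows "m = m'"
  using assms unfolding combining_order_def first_available_def by metis

text \<open>Holds for every game, with or without splitting moves: the number of terms falls to
  \<open>Z n\<close>, by one at each combining move and not at all at a splitting move.\<close>

lemma play_size:
  assumes "play available n s ms"
  shows "size s = Z n + length (filter (\<lambda>m. \<not> is_split m) ms)"
  using assms
proof (induction rule: play.induct)
  case (finish s)
  then show ?case by (simp add: size_zeckendorf_decomp)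
next
  case (step s m ms)
  then show ?case using size_make_move[of s m] by simp
qed

lemma zeckendorf_game_combining_moves:
  assumes "zeckendorf_game n ms"
  shows "n = Z n + length (filter (\<lambda>m. \<not> is_split m) ms)"
  using play_size assms by (fastforce simp: zeckendorf_game_def initial_state_def)

theorem theorem1p3:
  fixes n :: nat
  assumes "n \<ge> 1"
  shows "\<forall>ord \<in> {combine_largest, split_largest}.
      (\<exists>!ms. deterministic_game ord n ms) \<and>
      MS ord n = 0 \<and>
      int (MC ord n) = int n - int (Z n) \<and>
      zeckendorf_game n (game_moves ord n) \<and>
      int (length (game_moves ord n)) = int n - int (Z n) \<and>
      (\<forall>ms. zeckendorf_game n ms \<longrightarrow> int n - int (Z n) \<le> int (length ms))"
proof
  fix ord assume "ord \<in> {combine_largest, split_largest}"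
  then have ord: "combining_order ord"
    using combining_order_combine_largest combining_order_split_largest by blast
  from combining_play_exists[OF ord is_state_initial_state almost_sparse_initial_state]
  obtain ms where ms: "deterministic_game ord n ms" and nosplit: "\<forall>m\<in>set ms. \<not> is_split m"
    unfolding deterministic_game_def by blast
  have unique: "ms' = ms" if "deterministic_game ord n ms'" for ms'
    using play_unique[of "first_available ord"] first_available_unique[OF ord] that ms
    unfolding deterministic_game_def by metis
  have moves: "game_moves ord n = ms"
    unfolding game_moves_def using ms unique by (rule the_equality)
  have game: "zeckendorf_game n ms"
    using ms play_mono[of "first_available ord" n _ ms available]
    by (auto simp: deterministic_game_def zeckendorf_game_def first_available_def)
  have filters: "filter is_split ms = []" "filter (\<lambda>m. \<not> is_split m) ms = ms"
    using nosplit by (auto simp: filter_empty_conv filter_id_conv)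
  have len: "n = Z n + length ms"
    using zeckendorf_game_combining_moves[OF game] filters(2) by simp
  \<comment> \<open>In an arbitrary game the combining moves alone number \<open>n - Z n\<close>;
    splitting moves only add to the length.\<close>
  have "int n - int (Z n) \<le> int (length ms')" if "zeckendorf_game n ms'" for ms'
    using zeckendorf_game_combining_moves[OF that]
      length_filter_le[of "\<lambda>m. \<not> is_split m" ms'] by linarith
  moreover have "\<exists>!ms. deterministic_game ord n ms" using ms unique by blast
  moreover have "int (length ms) = int n - int (Z n)" using len by linarith
  ultimately show "(\<exists>!ms. deterministic_game ord n ms) \<and>
      MS ord n = 0 \<and>
      int (MC ord n) = int n - int (Z n) \<and>
      zeckendorf_game n (game_moves ord n) \<and>
      int (length (game_moves ord n)) = int n - int (Z n) \<and>
      (\<forall>ms. zeckendorf_game n ms \<longrightarrow> int n - int (Z n) \<le> int (length ms))"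
    using game filters by (simp add: MS_def MC_def moves)
qed

end
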